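(* There exists $n_0$ such that the following holds for every $n\geq n_0$. Let $G$ be a graph of order $n$ whose adjacency matrix has largest eigenvalue $\mu(G)$ satisfying $\mu(G)>\sqrt{\lfloor n^{2}/4\rfloor}$. Then $G$ contains a cycle of length $t$ for every integer $t$ with $3\leq t\leq n/320$.
   Context: Graphs are finite and simple. $\mu(G)$ denotes the largest eigenvalue of the adjacency matrix of $G$. *)

theory Defs
  imports Main "Jordan_Normal_Form.Char_Poly"
begin

definition simple_graph :: "nat \<Rightarrow> (nat \<Rightarrow> nat \<Rightarrow> bool) \<Rightarrow> bool" where
  "simple_graph n E \<longleftrightarrow> (\<forall>i j. E i j \<longrightarrow> i < n \<and> j < n \<and> i \<noteq> j \<and> E j i)"

definition adj_matrix :: "nat \<Rightarrow> (nat \<Rightarrow> nat \<Rightarrow> bool) \<Rightarrow> real mat" where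
  "adj_matrix n E = mat n n (\<lambda>(i, j). if E i j then 1 else 0)"

definition spectral_radius_graph :: "nat \<Rightarrow> (nat \<Rightarrow> nat \<Rightarrow> bool) \<Rightarrow> real" where
  "spectral_radius_graph n E = Max {k. eigenvalue (adj_matrix n E) k}"

definition has_cycle :: "nat \<Rightarrow> (nat \<Rightarrow> nat \<Rightarrow> bool) \<Rightarrow> nat \<Rightarrow> bool" where
  "has_cycle n E t \<longleftrightarrow> (\<exists>vs. length vs = t \<and> distinct vs \<and> set vs \<subseteq> {0..<n} \<and>
      (\<forall>i<t. E (vs ! i) (vs ! ((i + 1) mod t))))"

end

theory Submission
  imports Defs "Jordan_Normal_Form.Spectral_Radius" "HOL-Analysis.Function_Topology"
    "HOL-Analysis.Convex"
begin

text \<open>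
  Over nonnegative unit vectors, the quadratic form of the adjacency matrix of an induced
  subgraph of order \<open>m\<close> attains its maximum \<open>l\<close> at a Perron vector \<open>x\<close>.  If some degree is at
  most \<open>9m/20\<close>, then the Cauchy-Schwarz inequality at a vertex of that degree bounds the smallest
  entry of \<open>x\<close> so well that deleting its vertex lowers \<open>l\<close> by at most \<open>0.454 < 1/2\<close>.  Starting
  from \<open>l > sqrt (n\<^sup>2 div 4)\<close>, the deletions keep \<open>l > sqrt (m\<^sup>2 div 4)\<close>, and since \<open>l \<le> m\<close> they must
  stop while \<open>m\<close> is still more than \<open>0.08 n\<close>.  The graph that remains has all degrees above
  \<open>9m/20\<close>, and it is not bipartite, because a bipartite graph has \<open>l \<le> sqrt (m\<^sup>2 div 4)\<close>.

  In a non-bipartite graph of minimum degree well above \<open>2m/5\<close>, call two vertices related if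
  they have at least \<open>t\<close> common neighbours.  Among any three vertices two are related.  From this
  one finds an edge \<open>pq\<close> whose ends have many common relatives.  A path of relatives through them,
  interleaved with common neighbours, closes up to a cycle of even length at \<open>p\<close>, or to one of odd
  length by the edge \<open>pq\<close>.
\<close>

subsection \<open>Cycles in non-bipartite graphs of large minimum degree\<close>

text \<open>Inclusion-exclusion with the triple intersection dropped.\<close>

lemma card_three_subsets_le:
  assumes "finite S" "A \<subseteq> S" "B \<subseteq> S" "C \<subseteq> S"
  shows "card A + card B + card C \<le> card S + card (A \<inter> B) + card (A \<inter> C) + card (B \<inter> C)"
proof -
  have fin: "finite A" "finite B" "finite C"
    using assms by (auto intro: finite_subset)
  have "card A + card B = card (A \<union> B) + card (A \<inter> B)"
    using fin by (intro card_Un_Int) auto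
  moreover have "card (A \<union> B) + card C = card (A \<union> B \<union> C) + card ((A \<union> B) \<inter> C)"
    using fin by (intro card_Un_Int) auto
  moreover have "card ((A \<union> B) \<inter> C) \<le> card (A \<inter> C) + card (B \<inter> C)"
    by (metis Int_Un_distrib2 card_Un_le)
  moreover have "card (A \<union> B \<union> C) \<le> card S"
    using assms by (intro card_mono) auto
  ultimately show ?thesis by linarith
qed

lemma real_div_4_bounds:
  fixes k :: nat
  shows "4 * real (k div 4) \<le> real k" "real k \<le> 4 * real (k div 4) + 3"
proof -
  have "4 * (k div 4) \<le> k" "k \<le> 4 * (k div 4) + 3" by presburger+
  then show "4 * real (k div 4) \<le> real k" "real k \<le> 4 * real (k div 4) + 3" by linarith+
qed

text \<open>A greedy path that cannot be extended ends in a vertex unrelated to everything left over,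
  and then what is left over is a clique.\<close>

lemma path_if_no_independent_triple:
  assumes fin: "finite Z" and large: "2 * j \<le> card Z"
    and triple: "\<And>u v w. u \<in> Z \<Longrightarrow> v \<in> Z \<Longrightarrow> w \<in> Z \<Longrightarrow> R u v \<or> R u w \<or> R v w"
  shows "\<exists>zs. length zs = j \<and> distinct zs \<and> set zs \<subseteq> Z \<and> successively R zs"
proof -
  have "\<exists>zs. length zs = i \<and> distinct zs \<and> set zs \<subseteq> Z \<and> successively R zs" if "i \<le> j" for i
    using that
  proof (induction i)
    case 0
    show ?case by (intro exI[of _ "[]"]) auto
  next
    case (Suc i)
    then obtain zs where zs: "length zs = i" "distinct zs" "set zs \<subseteq> Z" "successively R zs"
      by auto
    have "card (Z - set zs) = card Z - i"
      using zs fin by (simp add: card_Diff_subset distinct_card)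
    \<comment> \<open>A stuck greedy path is discarded, so the leftover vertices alone must supply a
      path of the new length; \<open>2 * j \<le> card Z\<close> leaves enough of them.\<close>
    then have rest: "Suc i \<le> card (Z - set zs)"
      using Suc.prems large by linarith
    show ?case
    proof (cases "zs = [] \<or> (\<exists>z\<in>Z - set zs. R (last zs) z)")
      case True
      then obtain z where "z \<in> Z - set zs" "zs = [] \<or> R (last zs) z"
        using rest by (cases "Z - set zs = {}") auto
      then show ?thesis
        using zs by (intro exI[of _ "zs @ [z]"]) (auto simp: successively_append_iff)
    next
      case False
      obtain ws where ws: "set ws = Z - set zs" "distinct ws"
        using fin finite_distinct_list by blast
      have "R u v" if "u \<in> Z - set zs" "v \<in> Z - set zs" for u v
        using triple[of "last zs" u v] False that zs last_in_set[of zs] by blast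
      then have "R (ws ! l) (ws ! Suc l)" if "Suc l < length ws" for l
        using that ws(1) nth_mem[of l ws] nth_mem[of "Suc l" ws] by simp
      then have "successively R (take (Suc i) ws)"
        by (simp add: successively_conv_nth)
      moreover have "length (take (Suc i) ws) = Suc i"
        using rest ws distinct_card[of ws] by auto
      moreover have "set (take (Suc i) ws) \<subseteq> Z"
        using ws set_take_subset[of "Suc i" ws] by auto
      ultimately show ?thesis
        using ws distinct_take by blast
    qed
  qed
  then show ?thesis by blast
qed

section \<open>Induced subgraphs, bipartiteness and cycles\<close>

locale loopless_graph =
  fixes E :: "'a \<Rightarrow> 'a \<Rightarrow> bool"
  assumes sym: "E u v \<Longrightarrow> E v u" and irrefl: "\<not> E u u"
begin

text \<open>Induced subgraphs are vertex sets \<open>S\<close> under one fixed relation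
  \<open>E\<close>, so deleting a vertex changes only the set.\<close>

definition nbrs :: "'a set \<Rightarrow> 'a \<Rightarrow> 'a set" where
  "nbrs S v = {w \<in> S. E v w}"

definition edge_free :: "'a set \<Rightarrow> bool" where
  "edge_free A \<longleftrightarrow> (\<forall>u\<in>A. \<forall>v\<in>A. \<not> E u v)"

definition bipartite :: "'a set \<Rightarrow> bool" where
  "bipartite S \<longleftrightarrow> (\<exists>A B. S = A \<union> B \<and> A \<inter> B = {} \<and> edge_free A \<and> edge_free B)"

definition cycle_within :: "'a set \<Rightarrow> nat \<Rightarrow> bool" where
  "cycle_within S t \<longleftrightarrow> (\<exists>vs. length vs = t \<and> distinct vs \<and> set vs \<subseteq> S \<and>
     successively E vs \<and> E (last vs) (hd vs))"

lemma nbrs_subset: "nbrs S v \<subseteq> S"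
  by (auto simp: nbrs_def)

lemma finite_nbrs [simp]: "finite S \<Longrightarrow> finite (nbrs S v)"
  by (simp add: nbrs_def)

lemma bipartite_if_covered:
  assumes "S \<subseteq> A \<union> B" "edge_free A" "edge_free B"
  shows "bipartite S"
  unfolding bipartite_def
  by (rule exI[of _ "A \<inter> S"], rule exI[of _ "S - A"])
    (use assms in \<open>unfold edge_free_def, blast\<close>)

lemma edge_if_not_bipartite:
  assumes "\<not> bipartite S"
  obtains p q where "p \<in> S" "q \<in> S" "E p q"
  using assms bipartite_if_covered[of S S "{}"] by (auto simp: edge_free_def)

text \<open>Without triangles, the vertices sharing a neighbour with a fixed \<open>x\<close> form
  an edge-free set. For an edge \<open>p q\<close>, every vertex shares a neighbour with
  \<open>p\<close> or \<open>q\<close>, since three disjoint neighbourhoods would not fit into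
  \<open>S\<close>. So the sets at \<open>p\<close> and \<open>q\<close> cover
  \<open>S\<close>.\<close>

lemma triangle_if_not_bipartite:
  assumes fin: "finite S" and deg: "\<And>v. v \<in> S \<Longrightarrow> 2 * card S < 5 * card (nbrs S v)"
    and nb: "\<not> bipartite S"
  shows "cycle_within S 3"
proof (rule ccontr)
  assume no: "\<not> cycle_within S 3"
  have tf: False if "u \<in> S" "v \<in> S" "w \<in> S" "E u v" "E v w" "E w u" for u v w
  proof -
    have "cycle_within S 3"
      unfolding cycle_within_def
      using that irrefl by (intro exI[of _ "[u, v, w]"]) auto
    then show False using no by simp
  qed
  obtain p q where pq: "p \<in> S" "q \<in> S" "E p q"
    using nb edge_if_not_bipartite by blast
  define P where "P x = {v \<in> S. nbrs S v \<inter> nbrs S x \<noteq> {}}" for x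
  have indep: "edge_free (P x)" if x: "x \<in> S" for x
    unfolding edge_free_def
  proof (intro ballI notI)
    fix u v assume u: "u \<in> P x" and v: "v \<in> P x" and uv: "E u v"
    obtain w where w: "w \<in> S" "E u w" "E w x"
      using u sym by (auto simp: P_def nbrs_def)
    obtain w' where w': "w' \<in> S" "E x w'" "E w' v"
      using v sym by (auto simp: P_def nbrs_def)
    have uvS: "u \<in> S" "v \<in> S" using u v by (auto simp: P_def)
    let ?d = "\<lambda>a y. if E a y then 1 else 0 :: nat"
    have card_sum: "card (nbrs S a) = (\<Sum>y\<in>S. ?d a y)" for a
      using fin by (simp add: nbrs_def sum.If_cases Int_def)
    \<comment> \<open>The vertices \<open>u\<close>, \<open>w\<close>, \<open>x\<close>,
      \<open>w'\<close>, \<open>v\<close> form a closed walk of length five. No \<open>y\<close> is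
      adjacent to two consecutive ones, hence to at most two of the five, while the five degrees sum
      to more than \<open>2 * card S\<close>.\<close>
    have "card (nbrs S u) + card (nbrs S w) + card (nbrs S x) + card (nbrs S w') + card (nbrs S v)
        = (\<Sum>y\<in>S. ?d u y + ?d w y + ?d x y + ?d w' y + ?d v y)"
      by (simp add: card_sum sum.distrib)
    also have "\<dots> \<le> (\<Sum>y\<in>S. 2)"
    proof (rule sum_mono)
      fix y assume y: "y \<in> S"
      have "\<not> (E u y \<and> E w y)" "\<not> (E w y \<and> E x y)" "\<not> (E x y \<and> E w' y)"
        "\<not> (E w' y \<and> E v y)" "\<not> (E v y \<and> E u y)"
        using tf[OF _ _ y] sym uvS w w' x uv by blast+
      then show "?d u y + ?d w y + ?d x y + ?d w' y + ?d v y \<le> 2" by auto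
    qed
    finally show False
      using deg[OF uvS(1)] deg[OF uvS(2)] deg[OF w(1)] deg[OF w'(1)] deg[OF x] by simp
  qed
  have "v \<in> P p \<union> P q" if v: "v \<in> S" for v
  proof (rule ccontr)
    assume "v \<notin> P p \<union> P q"
    then have "nbrs S v \<inter> nbrs S p = {}" "nbrs S v \<inter> nbrs S q = {}"
      using v by (auto simp: P_def)
    moreover have "nbrs S p \<inter> nbrs S q = {}"
      using tf[OF pq(1,2) _ pq(3)] sym by (auto simp: nbrs_def)
    ultimately have "card (nbrs S v) + card (nbrs S p) + card (nbrs S q) \<le> card S"
      using card_three_subsets_le[OF fin nbrs_subset nbrs_subset nbrs_subset, of v p q] by simp
    then show False
      using deg[OF v] deg[OF pq(1)] deg[OF pq(2)] by linarith
  qed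
  then have "bipartite S"
    using bipartite_if_covered[of S "P p" "P q"] indep pq by auto
  with nb show False ..
qed

section \<open>Paths and cycles through common neighbours\<close>

definition many_common_nbrs :: "'a set \<Rightarrow> nat \<Rightarrow> 'a \<Rightarrow> 'a \<Rightarrow> bool" where
  "many_common_nbrs S t u v \<longleftrightarrow> t \<le> card (nbrs S u \<inter> nbrs S v)"

lemma many_common_nbrs_commute: "many_common_nbrs S t u v \<longleftrightarrow> many_common_nbrs S t v u"
  by (simp add: many_common_nbrs_def Int_commute)

text \<open>A fresh common neighbour is inserted between consecutive entries. The forbidden set
  \<open>F\<close> serves the induction, which adds the head to it before treating the tail. The
  budget keeps fewer than \<open>t\<close> vertices occupied at each insertion; with
  \<open>F\<close> empty it admits paths of up to \<open>t\<close> vertices.\<close>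

lemma interleave_common_nbrs:
  assumes fin: "finite S"
  shows "us \<noteq> [] \<Longrightarrow> distinct us \<Longrightarrow> set us \<subseteq> S \<Longrightarrow> successively (many_common_nbrs S t) us \<Longrightarrow>
    finite F \<Longrightarrow> set us \<inter> F = {} \<Longrightarrow> card F + 2 * length us \<le> Suc t \<Longrightarrow>
    \<exists>ws. length ws + 1 = 2 * length us \<and> distinct ws \<and> set ws \<subseteq> S - F \<and> successively E ws \<and>
      hd ws = hd us \<and> last ws = last us"
proof (induction us arbitrary: F)
  case Nil
  then show ?case by simp
next
  case (Cons u us)
  show ?case
  proof (cases us)
    case Nil
    then show ?thesis using Cons.prems by (intro exI[of _ "[u]"]) auto
  next
    case (Cons v vs)
    have "\<exists>ws. length ws + 1 = 2 * length us \<and> distinct ws \<and> set ws \<subseteq> S - insert u F \<and>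
        successively E ws \<and> hd ws = hd us \<and> last ws = last us"
      using Cons.prems local.Cons by (intro Cons.IH) (auto simp: card_insert_if)
    then obtain ws where ws: "length ws + 1 = 2 * length us" "distinct ws"
      "set ws \<subseteq> S - insert u F" "successively E ws" "hd ws = v" "last ws = last us"
      using local.Cons by auto
    have ne: "ws \<noteq> []" using ws(1) by auto
    have "card (F \<union> set ws \<union> {u}) \<le> card F + length ws + 1"
      using card_Un_le[of "F \<union> set ws" "{u}"] card_Un_le[of F "set ws"] card_length[of ws] by simp
    also have "\<dots> < t"
      using Cons.prems ws(1) by simp
    also have "t \<le> card (nbrs S u \<inter> nbrs S v)"
      using Cons.prems local.Cons by (simp add: many_common_nbrs_def)
    finally have "\<not> nbrs S u \<inter> nbrs S v \<subseteq> F \<union> set ws \<union> {u}"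
      using card_mono[of "F \<union> set ws \<union> {u}" "nbrs S u \<inter> nbrs S v"] Cons.prems(5) by auto
    then obtain w where w: "w \<in> S" "E u w" "E v w" "w \<notin> F" "w \<notin> set ws" "w \<noteq> u"
      by (auto simp: nbrs_def)
    show ?thesis
      using ws w ne sym Cons.prems local.Cons
      by (intro exI[of _ "u # w # ws"]) (auto simp: successively_Cons)
  qed
qed

text \<open>Three neighbourhoods that pairwise share fewer than \<open>t\<close> vertices would not
  fit into \<open>S\<close>.\<close>

lemma no_independent_triple:
  assumes fin: "finite S" and deg: "\<And>v. v \<in> S \<Longrightarrow> \<delta> \<le> card (nbrs S v)"
    and large: "card S + 3 * t \<le> 3 * \<delta>" 
    and "u \<in> S" "v \<in> S" "w \<in> S"
  shows "many_common_nbrs S t u v \<or> many_common_nbrs S t u w \<or> many_common_nbrs S t v w"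
  using card_three_subsets_le[OF fin nbrs_subset nbrs_subset nbrs_subset, of u v w]
    deg[of u] deg[of v] deg[of w] assms
  unfolding many_common_nbrs_def by linarith

text \<open>Otherwise any set with \<open>t + 2\<close> common relatives is edge-free.  For an edge \<open>pq\<close>, this
  applies to the vertices unrelated to \<open>p\<close> and to those unrelated to \<open>q\<close>, which together miss at
  most \<open>t + 1\<close> vertices; sorting all vertices by which of the two sets holds many of their
  neighbours extends this pair to a bipartition.\<close>

lemma edge_with_many_common_relatives:
  assumes fin: "finite S" and deg: "\<And>v. v \<in> S \<Longrightarrow> \<delta> \<le> card (nbrs S v)"
    and large: "2 * card S + 5 * t + 6 \<le> 5 * \<delta>" "3 * t + 6 \<le> \<delta>"
    and nb: "\<not> bipartite S"
  obtains p q where "p \<in> S" "q \<in> S" "E p q"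
    "t + 2 \<le> card {z \<in> S. many_common_nbrs S t z p \<and> many_common_nbrs S t z q}"
proof (rule ccontr)
  assume no_edge: "\<not> thesis"
  note edge = that
  have few: "card {z \<in> S. many_common_nbrs S t z p \<and> many_common_nbrs S t z q} < t + 2"
    if "p \<in> S" "q \<in> S" "E p q" for p q
    using that edge no_edge by (meson not_le)
  obtain p q where pq: "p \<in> S" "q \<in> S" "E p q"
    using nb edge_if_not_bipartite by blast
  have deg_le: "\<delta> \<le> card S"
    using deg[OF pq(1)] card_mono[OF fin nbrs_subset[of S p]] by linarith
  have triple: "many_common_nbrs S t u v \<or> many_common_nbrs S t u w \<or> many_common_nbrs S t v w"
    if "u \<in> S" "v \<in> S" "w \<in> S" for u v w
    using no_independent_triple[OF fin deg] that large by simp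
  define X where "X x = {v \<in> S. \<not> many_common_nbrs S t x v}" for x
  have X_subset: "X x \<subseteq> S" for x by (auto simp: X_def)
  have fin_X: "finite (X x)" for x using fin X_subset finite_subset by blast
  have clique: "many_common_nbrs S t u v" if "x \<in> S" "u \<in> X x" "v \<in> X x" for x u v
    using triple[of x u v] that by (auto simp: X_def)
  have indep: "edge_free A" if A: "A \<subseteq> S" "Z \<subseteq> S" "t + 2 \<le> card Z"
    "\<And>u z. u \<in> A \<Longrightarrow> z \<in> Z \<Longrightarrow> many_common_nbrs S t z u" for A Z
    unfolding edge_free_def
  proof (intro ballI notI)
    fix u v assume uv: "u \<in> A" "v \<in> A" "E u v"
    have "card Z \<le> card {z \<in> S. many_common_nbrs S t z u \<and> many_common_nbrs S t z v}"
      using fin A uv by (intro card_mono) auto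
    moreover have "card {z \<in> S. many_common_nbrs S t z u \<and> many_common_nbrs S t z v} < t + 2"
      using few uv A(1) by blast
    ultimately show False using A(3) by linarith
  qed
  \<comment> \<open>By \<open>clique\<close>, \<open>X x\<close> is its own supply of common
    relatives.\<close>
  have indep_X: "edge_free (X x)" if "x \<in> S" "t + 2 \<le> card (X x)" for x
    using indep[OF X_subset X_subset that(2)] clique that by blast
  have indep_le: "card (X x) + \<delta> \<le> card S" if x: "x \<in> S" "t + 2 \<le> card (X x)" for x
  proof -
    obtain y where y: "y \<in> X x" using x(2) by (cases "X x = {}") auto
    have "nbrs S y \<subseteq> S - X x"
      using indep_X[OF x] y by (auto simp: nbrs_def edge_free_def)
    then have "card (nbrs S y) \<le> card (S - X x)"
      using fin by (intro card_mono) auto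
    also have "\<dots> = card S - card (X x)"
      using fin_X X_subset by (simp add: card_Diff_subset)
    finally have "card (nbrs S y) \<le> card S - card (X x)" .
    moreover have "\<delta> \<le> card (nbrs S y)"
      using deg y X_subset by blast
    ultimately show ?thesis
      using card_mono[OF fin X_subset[of x]] by linarith
  qed
  have rest: "card (S - (X p \<union> X q)) < t + 2"
  proof -
    have "S - (X p \<union> X q) = {z \<in> S. many_common_nbrs S t z p \<and> many_common_nbrs S t z q}"
      by (auto simp: X_def many_common_nbrs_commute)
    then show ?thesis using few pq by simp
  qed
  have cover: "card S < card (X p) + card (X q) + t + 2"
  proof -
    have "card S = card (X p \<union> X q) + card (S - (X p \<union> X q))"
      using fin X_subset fin_X card_mono[OF fin, of "X p \<union> X q"] by (simp add: card_Diff_subset)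
    then show ?thesis
      using rest card_Un_le[of "X p" "X q"] by linarith
  qed
  \<comment> \<open>Were one of the two smaller, \<open>cover\<close> would make the other exceed
    \<open>card S - \<delta>\<close>, against \<open>indep_le\<close>, or make \<open>S\<close>
    itself smaller than \<open>\<delta>\<close>.\<close>
  have big: "t + 2 \<le> card (X p)" "t + 2 \<le> card (X q)"
    using indep_le[OF pq(1)] indep_le[OF pq(2)] cover large deg_le by linarith+
  \<comment> \<open>A vertex of \<open>X x\<close> has all but at most \<open>t + 1\<close> of its
    neighbours in \<open>X y\<close>, which has at most \<open>card S - \<delta>\<close> elements.
    The threshold forces a vertex of \<open>W (X y)\<close> to share at least \<open>t\<close>
    neighbours with it, so all of \<open>X x\<close> are common relatives of
    \<open>W (X y)\<close>.\<close>
  define W where "W Y = {v \<in> S. 2 * t + 2 + card S \<le> card (nbrs S v \<inter> Y) + 2 * \<delta>}" for Y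
  have side: "edge_free (W (X y))"
    if xy: "x \<in> S" "y \<in> S" "t + 2 \<le> card (X x)" "t + 2 \<le> card (X y)"
      "card (S - (X x \<union> X y)) < t + 2" for x y
  proof (rule indep[of _ "X x"])
    show "W (X y) \<subseteq> S" by (auto simp: W_def)
    show "X x \<subseteq> S" "t + 2 \<le> card (X x)" using X_subset xy by auto
    fix v u assume v: "v \<in> W (X y)" and u: "u \<in> X x"
    have "nbrs S u \<subseteq> (nbrs S u \<inter> X y) \<union> (S - (X x \<union> X y))"
      using indep_X[OF xy(1,3)] u by (auto simp: nbrs_def edge_free_def)
    then have "card (nbrs S u) \<le> card ((nbrs S u \<inter> X y) \<union> (S - (X x \<union> X y)))"
      using fin by (intro card_mono) auto
    also have "\<dots> \<le> card (nbrs S u \<inter> X y) + card (S - (X x \<union> X y))"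
      by (rule card_Un_le)
    finally have "card (nbrs S u) \<le> card (nbrs S u \<inter> X y) + card (S - (X x \<union> X y))" .
    with xy(5) have u_deg: "\<delta> < card (nbrs S u \<inter> X y) + t + 2"
      using deg[of u] subsetD[OF X_subset u] by linarith
    have "card (nbrs S u \<inter> X y) + card (nbrs S v \<inter> X y)
        = card (nbrs S u \<inter> X y \<union> nbrs S v \<inter> X y) + card (nbrs S u \<inter> X y \<inter> (nbrs S v \<inter> X y))"
      using fin by (intro card_Un_Int) auto
    moreover have "card (nbrs S u \<inter> X y \<union> nbrs S v \<inter> X y) \<le> card (X y)"
      using fin_X by (intro card_mono) auto
    moreover have "card (nbrs S u \<inter> X y \<inter> (nbrs S v \<inter> X y)) \<le> card (nbrs S u \<inter> nbrs S v)"
      using fin by (intro card_mono) auto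
    ultimately show "many_common_nbrs S t u v"
      using u_deg v indep_le[OF xy(2,4)] unfolding many_common_nbrs_def W_def by auto
  qed
  \<comment> \<open>Below both thresholds, \<open>v\<close> would have at most
    \<open>2 * card S + 5 * t + 3 - 4 * \<delta>\<close> neighbours, which is less than
    \<open>\<delta>\<close>.\<close>
  have "v \<in> W (X q) \<union> W (X p)" if v: "v \<in> S" for v
  proof (rule ccontr)
    assume "v \<notin> W (X q) \<union> W (X p)"
    then have "card (nbrs S v \<inter> X q) + 2 * \<delta> < 2 * t + 2 + card S"
      "card (nbrs S v \<inter> X p) + 2 * \<delta> < 2 * t + 2 + card S"
      using v by (auto simp: W_def)
    moreover have "card (nbrs S v) \<le> card (nbrs S v \<inter> X q) + card (nbrs S v \<inter> X p)
        + card (S - (X p \<union> X q))"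
    proof -
      have "card (nbrs S v)
          \<le> card ((nbrs S v \<inter> X q) \<union> (nbrs S v \<inter> X p) \<union> (S - (X p \<union> X q)))"
        using fin by (intro card_mono) (auto simp: nbrs_def)
      then show ?thesis
        using card_Un_le[of "(nbrs S v \<inter> X q) \<union> (nbrs S v \<inter> X p)" "S - (X p \<union> X q)"]
          card_Un_le[of "nbrs S v \<inter> X q" "nbrs S v \<inter> X p"] by linarith
    qed
    ultimately show False
      using deg[OF v] rest large by linarith
  qed
  moreover have "edge_free (W (X q))" "edge_free (W (X p))"
    using side[of p q] side[of q p] pq big rest by (simp_all add: Un_commute)
  ultimately have "bipartite S"
    using bipartite_if_covered by blast
  with nb show False ..
qed

lemma cycle_if_not_bipartite:
  assumes fin: "finite S" and deg: "\<And>v. v \<in> S \<Longrightarrow> \<delta> \<le> card (nbrs S v)"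
    and large: "2 * card S + 5 * t + 6 \<le> 5 * \<delta>" "3 * t + 6 \<le> \<delta>"
    and nb: "\<not> bipartite S" and t: "3 \<le> t"
  shows "cycle_within S t"
\<comment> \<open>For \<open>t = 3\<close> the odd construction below would have no relatives
  between \<open>p\<close> and \<open>q\<close>, and these two need not be related to each
  other.\<close>
proof (cases "t = 3")
  case True
  have "2 * card S < 5 * card (nbrs S v)" if "v \<in> S" for v
    using deg[OF that] large by linarith
  then show ?thesis
    using triangle_if_not_bipartite[OF fin _ nb] True by blast
next
  case False
  let ?R = "many_common_nbrs S t"
  obtain p q where pq: "p \<in> S" "q \<in> S" "E p q" "t + 2 \<le> card {z \<in> S. ?R z p \<and> ?R z q}"
    using edge_with_many_common_relatives[OF fin deg large nb] by blast
  \<comment> \<open>Vertices of large degree are related to themselves, so \<open>p\<close> and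
    \<open>q\<close> may be among the common relatives; the surplus in \<open>t + 2\<close> pays for
    their removal.\<close>
  define Z where "Z = {z \<in> S. ?R z p \<and> ?R z q} - {p, q}"
  have "p \<noteq> q" using pq irrefl by blast
  then have card_Z: "t \<le> card Z"
    using pq(4) diff_card_le_card_Diff[of "{p, q}" "{z \<in> S. ?R z p \<and> ?R z q}"]
    by (simp add: Z_def)
  have Z_subset: "Z \<subseteq> S" and fin_Z: "finite Z"
    using fin by (auto simp: Z_def)
  have path: "\<exists>zs. length zs = j \<and> distinct zs \<and> set zs \<subseteq> Z \<and> successively ?R zs"
    if "2 * j \<le> t" for j
  proof (rule path_if_no_independent_triple[OF fin_Z])
    show "2 * j \<le> card Z" using that card_Z by linarith
    show "?R u v \<or> ?R u w \<or> ?R v w" if "u \<in> Z" "v \<in> Z" "w \<in> Z" for u v w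
      using no_independent_triple[OF fin deg] that Z_subset large by (simp add: subset_iff)
  qed
  show ?thesis
  proof (cases "even t")
    case True
    then obtain k where k: "t = 2 * k" by blast
    \<comment> \<open>With \<open>p\<close> in front these are \<open>k\<close> vertices, which
      interleave to \<open>t - 1\<close>; one of the \<open>t\<close> common neighbours of
      \<open>last zs\<close> and \<open>p\<close> is still free and closes the cycle.\<close>
    obtain zs where zs: "length zs = k - 1" "distinct zs" "set zs \<subseteq> Z" "successively ?R zs"
      using path[of "k - 1"] k by (auto simp: diff_mult_distrib2)
    have zs_ne: "zs \<noteq> []" using zs(1) k False t by auto
    have "hd zs \<in> Z" "last zs \<in> Z"
      using zs(3) hd_in_set[OF zs_ne] last_in_set[OF zs_ne] by auto
    then have "?R p (hd zs)" and last: "?R (last zs) p"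
      by (auto simp: Z_def many_common_nbrs_commute)
    then have "\<exists>ws. length ws + 1 = 2 * length (p # zs) \<and> distinct ws \<and> set ws \<subseteq> S - {} \<and>
        successively E ws \<and> hd ws = hd (p # zs) \<and> last ws = last (p # zs)"
      using zs zs_ne pq Z_subset k False t
      by (intro interleave_common_nbrs[OF fin]) (auto simp: successively_Cons Z_def)
    then obtain ws where ws: "length ws + 1 = t" "distinct ws" "set ws \<subseteq> S" "successively E ws"
      "hd ws = p" "last ws = last zs"
      using zs zs_ne k False t by (auto simp: Suc_diff_Suc)
    have "card (set ws) < card (nbrs S (last zs) \<inter> nbrs S p)"
      using ws(1) card_length[of ws] last by (simp add: many_common_nbrs_def)
    then have "\<not> nbrs S (last zs) \<inter> nbrs S p \<subseteq> set ws"
      using card_mono[of "set ws" "nbrs S (last zs) \<inter> nbrs S p"] by auto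
    then obtain w where w: "w \<in> S" "E (last zs) w" "E p w" "w \<notin> set ws"
      by (auto simp: nbrs_def)
    show ?thesis
      unfolding cycle_within_def
    proof (intro exI[of _ "w # ws"] conjI)
      show "length (w # ws) = t" using ws by simp
      show "distinct (w # ws)" "set (w # ws) \<subseteq> S" using ws w by auto
      show "successively E (w # ws)" using ws w sym by (auto simp: successively_Cons)
      show "E (last (w # ws)) (hd (w # ws))"
        using ws w t by auto
    qed
  next
    case odd: False
    then obtain k where k: "t = 2 * k + 1" by (blast elim: oddE)
    \<comment> \<open>With \<open>p\<close> and \<open>q\<close> as ends these are
      \<open>k + 1\<close> vertices, which interleave to exactly \<open>t\<close>; the edge
      \<open>p q\<close> closes the cycle.\<close>
    obtain zs where zs: "length zs = k - 1" "distinct zs" "set zs \<subseteq> Z" "successively ?R zs"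
      using path[of "k - 1"] k by force
    have zs_ne: "zs \<noteq> []" using zs(1) k False t by auto
    have "hd zs \<in> Z" "last zs \<in> Z"
      using zs(3) hd_in_set[OF zs_ne] last_in_set[OF zs_ne] by auto
    then have "?R p (hd zs)" "?R (last zs) q"
      by (auto simp: Z_def many_common_nbrs_commute)
    then have "\<exists>ws. length ws + 1 = 2 * length (p # zs @ [q]) \<and> distinct ws \<and> set ws \<subseteq> S - {} \<and>
        successively E ws \<and> hd ws = hd (p # zs @ [q]) \<and> last ws = last (p # zs @ [q])"
      using zs zs_ne pq Z_subset k False t \<open>p \<noteq> q\<close>
      by (intro interleave_common_nbrs[OF fin])
        (auto simp: successively_Cons successively_append_iff Z_def)
    then obtain ws where "length ws = t" "distinct ws" "set ws \<subseteq> S" "successively E ws"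
      "hd ws = p" "last ws = q"
      using zs zs_ne k False t by auto
    then show ?thesis
      unfolding cycle_within_def using pq sym by blast
  qed
qed

subsection \<open>Perron vectors of induced subgraphs\<close>


definition adj :: "'a set \<Rightarrow> ('a \<Rightarrow> real) \<Rightarrow> 'a \<Rightarrow> real" where
  "adj S x i = (\<Sum>j\<in>S. if E i j then x j else 0)"

definition quad :: "'a set \<Rightarrow> ('a \<Rightarrow> real) \<Rightarrow> real" where
  "quad S x = (\<Sum>i\<in>S. x i * adj S x i)"

definition sqnorm :: "'a set \<Rightarrow> ('a \<Rightarrow> real) \<Rightarrow> real" where
  "sqnorm S x = (\<Sum>i\<in>S. (x i)\<^sup>2)"

text \<open>\<open>l\<close> is the maximal Rayleigh quotient. The homogeneous form of the bound
  applies to perturbed or restricted vectors without normalising them.\<close>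

definition perron :: "'a set \<Rightarrow> real \<Rightarrow> ('a \<Rightarrow> real) \<Rightarrow> bool" where
  "perron S l x \<longleftrightarrow> (\<forall>i. 0 \<le> x i) \<and> sqnorm S x = 1 \<and> quad S x = l \<and>
     (\<forall>y. quad S y \<le> l * sqnorm S y)"

lemma adj_eq_sum_nbrs: "finite S \<Longrightarrow> adj S x i = (\<Sum>j\<in>nbrs S i. x j)"
  by (simp add: adj_def nbrs_def sum.inter_filter)

lemma adj_cong: "(\<And>j. j \<in> S \<Longrightarrow> x j = y j) \<Longrightarrow> adj S x i = adj S y i"
  unfolding adj_def by (intro sum.cong) auto

lemma quad_cong: "(\<And>j. j \<in> S \<Longrightarrow> x j = y j) \<Longrightarrow> quad S x = quad S y"
  unfolding quad_def by (intro sum.cong refl arg_cong2[where f = "(*)"] adj_cong)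

lemma adj_scale: "adj S (\<lambda>i. c * x i) i = c * adj S x i"
  unfolding adj_def sum_distrib_left by (intro sum.cong) auto

lemma quad_scale: "quad S (\<lambda>i. c * x i) = c\<^sup>2 * quad S x"
  by (simp add: quad_def adj_scale sum_distrib_left power2_eq_square mult_ac)

lemma sqnorm_scale: "sqnorm S (\<lambda>i. c * x i) = c\<^sup>2 * sqnorm S x"
  by (simp add: sqnorm_def sum_distrib_left power_mult_distrib)

lemma sqnorm_remove:
  assumes "finite S" "u \<in> S"
  shows "sqnorm S x = (x u)\<^sup>2 + sqnorm (S - {u}) x"
  unfolding sqnorm_def using assms by (rule sum.remove)

text \<open>By symmetry the row and the column of \<open>u\<close> contribute equally, and the
  diagonal entry is zero.\<close>

lemma quad_remove:
  assumes fin: "finite S" and u: "u \<in> S"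
  shows "quad S x = quad (S - {u}) x + 2 * x u * adj S x u"
proof -
  have adj_split: "adj S x i = (if E u i then x u else 0) + adj (S - {u}) x i" for i
    using sum.remove[OF fin u, of "\<lambda>j. if E i j then x j else 0"] sym[of u i] sym[of i u]
    by (auto simp: adj_def)
  have "quad S x = x u * adj S x u + (\<Sum>i\<in>S - {u}. x i * adj S x i)"
    unfolding quad_def by (rule sum.remove[OF fin u])
  also have "(\<Sum>i\<in>S - {u}. x i * adj S x i)
      = (\<Sum>i\<in>S - {u}. x u * (if E u i then x i else 0)) + quad (S - {u}) x"
    unfolding quad_def sum.distrib[symmetric] by (intro sum.cong) (auto simp: adj_split distrib_left)
  also have "(\<Sum>i\<in>S - {u}. x u * (if E u i then x i else 0)) = x u * adj S x u"
    using adj_split[of u] irrefl by (simp add: adj_def sum_distrib_left[symmetric])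
  finally show ?thesis by simp
qed

text \<open>A maximiser exists by compactness, and taking absolute values of its entries does not
  decrease the form.\<close>

lemma perron_exists:
  assumes fin: "finite S" and ne: "S \<noteq> {}"
  shows "\<exists>l x. perron S l x"
proof -
  \<comment> \<open>Vectors are functions on the whole type, so the norm on \<open>S\<close> leaves
    the other coordinates free; the cube confines them and is compact by Tychonoff.\<close>
  define K where "K = (\<Pi>\<^sub>E i\<in>UNIV. {-1..1::real}) \<inter> {x :: 'a \<Rightarrow> real. sqnorm S x = 1}"
  have coord: "continuous_on T (\<lambda>x :: 'a \<Rightarrow> real. x i)" for i T
    by (rule continuous_on_subset[OF continuous_on_product_coordinates]) simp
  have "compact (\<Pi>\<^sub>E i\<in>(UNIV :: 'a set). {-1..1::real})"
    using compactin_PiE[of "\<lambda>_. euclidean" UNIV "\<lambda>_. {-1..1::real}"]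
    by (simp add: euclidean_product_topology)
  moreover have "closed {x :: 'a \<Rightarrow> real. sqnorm S x = 1}"
    unfolding sqnorm_def by (intro closed_Collect_eq continuous_intros coord)
  ultimately have "compact K"
    unfolding K_def by (rule compact_Int_closed)
  moreover have "K \<noteq> {}"
  proof -
    obtain u where u: "u \<in> S" using ne by blast
    have "(\<lambda>i. if i = u then 1 else 0) \<in> K"
      using fin u by (auto simp: K_def sqnorm_def if_distrib[of "\<lambda>a. a\<^sup>2"] cong: if_cong)
    then show ?thesis by blast
  qed
  moreover have "continuous_on K (quad S)"
  proof -
    have "continuous_on K (\<lambda>x. if E i j then x j else 0)" for i j
      by (cases "E i j") (auto intro: coord)
    then show ?thesis
      unfolding quad_def[abs_def] adj_def by (intro continuous_intros coord)
  qed
  ultimately obtain x where x: "x \<in> K" and max: "\<And>y. y \<in> K \<Longrightarrow> quad S y \<le> quad S x"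
    using continuous_attains_sup[of K "quad S"] by blast
  have bound: "quad S y \<le> quad S x * sqnorm S y" for y
  proof (cases "sqnorm S y = 0")
    case True
    then have "y i = 0" if "i \<in> S" for i
      using that fin by (simp add: sqnorm_def sum_nonneg_eq_0_iff)
    then show ?thesis using True by (simp add: quad_def)
  next
    case False
    have nn: "0 \<le> sqnorm S y" by (simp add: sqnorm_def sum_nonneg)
    define z where "z i = (1 / sqrt (sqnorm S y)) * y i" for i
    have z_norm: "sqnorm S z = 1"
      unfolding z_def[abs_def] sqnorm_scale using False nn by (simp add: power_divide)
    define w where "w i = (if i \<in> S then z i else 0)" for i
    have w_norm: "sqnorm S w = 1"
      using z_norm by (simp add: sqnorm_def w_def)
    have "\<bar>w i\<bar> \<le> 1" for i
    proof (cases "i \<in> S")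
      case True
      have "(w i)\<^sup>2 \<le> sqnorm S w"
        unfolding sqnorm_def using fin True by (intro member_le_sum) auto
      then show ?thesis using w_norm by (simp add: abs_square_le_1)
    qed (simp add: w_def)
    then have "w \<in> K"
      using w_norm by (simp add: K_def PiE_UNIV_domain abs_le_iff minus_le_iff[of _ 1])
    then have "quad S w \<le> quad S x" by (rule max)
    also have "quad S w = quad S z" by (rule quad_cong) (simp add: w_def)
    also have "\<dots> = quad S y / sqnorm S y"
      unfolding z_def[abs_def] quad_scale using nn by (simp add: power_divide)
    finally show ?thesis
      using False nn by (simp add: divide_le_eq)
  qed
  have x_norm: "sqnorm S x = 1" using x by (simp add: K_def)
  have abs_norm: "sqnorm S (\<lambda>i. \<bar>x i\<bar>) = 1" using x_norm by (simp add: sqnorm_def)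
  have "quad S x \<le> quad S (\<lambda>i. \<bar>x i\<bar>)"
    unfolding quad_def adj_def sum_distrib_left
    by (intro sum_mono) (auto simp: abs_mult[symmetric])
  then have "quad S (\<lambda>i. \<bar>x i\<bar>) = quad S x"
    using bound[of "\<lambda>i. \<bar>x i\<bar>"] abs_norm by simp
  then have "perron S (quad S x) (\<lambda>i. \<bar>x i\<bar>)"
    using bound abs_norm by (simp add: perron_def)
  then show ?thesis by blast
qed

lemma perron_value_nonneg:
  assumes P: "perron S l x"
  shows "0 \<le> l"
proof -
  have "0 \<le> quad S x"
    using P unfolding perron_def quad_def adj_def
    by (intro sum_nonneg mult_nonneg_nonneg) auto
  then show ?thesis using P by (simp add: perron_def)
qed

text \<open>First-order condition at the maximum: changing the entry at \<open>u\<close> by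
  \<open>h\<close> gives \<open>2 * h * d \<le> l * h\<^sup>2\<close> for every \<open>h\<close>,
  which forces \<open>d = 0\<close>.\<close>

lemma perron_eigen:
  assumes fin: "finite S" and P: "perron S l x" and u: "u \<in> S"
  shows "adj S x u = l * x u"
proof -
  define d where "d = adj S x u - l * x u"
  have l: "0 \<le> l" using perron_value_nonneg[OF P] .
  have "2 * h * d \<le> l * h\<^sup>2" for h
  proof -
    define y where "y = x(u := x u + h)"
    have "adj S y u = adj S x u"
      unfolding adj_def using irrefl by (intro sum.cong) (auto simp: y_def)
    moreover have "quad (S - {u}) y = quad (S - {u}) x"
      by (rule quad_cong) (simp add: y_def)
    ultimately have "quad S y = l + 2 * h * adj S x u"
      using quad_remove[OF fin u, of y] quad_remove[OF fin u, of x] P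
      by (simp add: y_def perron_def algebra_simps)
    moreover have "sqnorm (S - {u}) y = sqnorm (S - {u}) x"
      unfolding sqnorm_def by (intro sum.cong) (auto simp: y_def)
    then have "sqnorm S y = 1 + 2 * h * x u + h\<^sup>2"
      using sqnorm_remove[OF fin u, of y] sqnorm_remove[OF fin u, of x] P
      by (simp add: y_def perron_def power2_eq_square algebra_simps)
    moreover have "quad S y \<le> l * sqnorm S y" using P by (simp add: perron_def)
    ultimately show ?thesis by (simp add: d_def algebra_simps)
  qed
  \<comment> \<open>The denominator is \<open>l + 1\<close> because \<open>l\<close> may be
    zero.\<close>
  from this[of "d / (l + 1)"] have "d\<^sup>2 / (l + 1) * 2 \<le> d\<^sup>2 / (l + 1) * (l / (l + 1))"
    by (simp add: power2_eq_square mult_ac)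
  moreover have "l / (l + 1) < 2" using l by (simp add: divide_less_eq)
  ultimately have "d\<^sup>2 / (l + 1) \<le> 0"
    by (meson mult_strict_left_mono not_le)
  then have "d = 0"
    using l by (simp add: divide_le_0_iff)
  then show ?thesis by (simp add: d_def)
qed

section \<open>Upper bounds for the Perron value\<close>

lemma perron_value_le_card:
  assumes fin: "finite S" and P: "perron S l x"
  shows "l \<le> card S"
proof -
  have "l = (\<Sum>i\<in>S. x i * adj S x i)"
    using P by (simp add: perron_def quad_def)
  also have "\<dots> \<le> (\<Sum>i\<in>S. x i * (\<Sum>j\<in>S. x j))"
    unfolding adj_def using P
    by (intro sum_mono mult_left_mono) (auto simp: perron_def)
  also have "\<dots> = (\<Sum>i\<in>S. x i)\<^sup>2"
    by (simp add: sum_distrib_right[symmetric] power2_eq_square)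
  also have "\<dots> \<le> (\<Sum>i\<in>S. (x i)\<^sup>2) * card S"
    by (rule sum_squared_le_sum_of_squares)
  finally show ?thesis using P by (simp add: perron_def sqnorm_def)
qed

text \<open>With entry sums \<open>a\<close> and \<open>b\<close> over the two sides,
  \<open>l \<le> 2 * (a * b)\<close>. Cauchy-Schwarz on each side and
  \<open>\<alpha> * \<beta> \<le> 1 / 4\<close> bound the square by \<open>card A * card B\<close>,
  an integer, so the floor is respected.\<close>

lemma perron_value_le_if_bipartite:
  assumes fin: "finite S" and P: "perron S l x" and bip: "bipartite S"
  shows "l \<le> sqrt (real ((card S)\<^sup>2 div 4))"
proof -
  obtain A B where AB: "S = A \<union> B" "A \<inter> B = {}" "edge_free A" "edge_free B"
    using bip by (auto simp: bipartite_def)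
  have fins: "finite A" "finite B" using fin AB by auto
  have x: "0 \<le> x i" for i using P by (simp add: perron_def)
  define a b where "a = sum x A" and "b = sum x B"
  have ab: "0 \<le> a" "0 \<le> b" by (simp_all add: a_def b_def sum_nonneg x)
  have adj_A: "adj S x i \<le> b" if "i \<in> A" for i
  proof -
    have "nbrs S i \<subseteq> B" using AB that by (auto simp: nbrs_def edge_free_def)
    then show ?thesis
      unfolding adj_eq_sum_nbrs[OF fin] b_def using fins x by (intro sum_mono2) auto
  qed
  have adj_B: "adj S x i \<le> a" if "i \<in> B" for i
  proof -
    have "nbrs S i \<subseteq> A" using AB that by (auto simp: nbrs_def edge_free_def)
    then show ?thesis
      unfolding adj_eq_sum_nbrs[OF fin] a_def using fins x by (intro sum_mono2) auto
  qed
  have "l = (\<Sum>i\<in>A. x i * adj S x i) + (\<Sum>i\<in>B. x i * adj S x i)"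
    using P AB fins by (simp add: perron_def quad_def sum.union_disjoint)
  also have "\<dots> \<le> (\<Sum>i\<in>A. x i * b) + (\<Sum>i\<in>B. x i * a)"
    using adj_A adj_B x by (intro add_mono sum_mono mult_left_mono) auto
  also have "\<dots> = 2 * (a * b)"
    by (simp add: a_def b_def sum_distrib_right[symmetric])
  finally have l: "l \<le> 2 * (a * b)" .
  define \<alpha> \<beta> where "\<alpha> = sqnorm A x" and "\<beta> = sqnorm B x"
  have nn: "0 \<le> \<alpha>" "0 \<le> \<beta>" by (simp_all add: \<alpha>_def \<beta>_def sqnorm_def sum_nonneg)
  have one: "\<alpha> + \<beta> = 1"
    using P AB fins by (simp add: \<alpha>_def \<beta>_def perron_def sqnorm_def sum.union_disjoint)
  have "a\<^sup>2 \<le> \<alpha> * card A" "b\<^sup>2 \<le> \<beta> * card B"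
    unfolding a_def b_def \<alpha>_def \<beta>_def sqnorm_def by (rule sum_squared_le_sum_of_squares)+
  then have "a\<^sup>2 * b\<^sup>2 \<le> (\<alpha> * card A) * (\<beta> * card B)"
    using nn by (intro mult_mono) auto
  also have "\<dots> = (\<alpha> * \<beta>) * (card A * card B)" by simp
  also have "\<dots> \<le> (1 / 4) * (card A * card B)"
  proof (intro mult_right_mono)
    have "0 \<le> (\<alpha> - \<beta>)\<^sup>2" by simp
    also have "\<dots> = (\<alpha> + \<beta>)\<^sup>2 - 4 * (\<alpha> * \<beta>)" by (simp add: power2_eq_square algebra_simps)
    finally show "\<alpha> * \<beta> \<le> 1 / 4" using one by simp
  qed simp
  finally have "(2 * (a * b))\<^sup>2 \<le> real (card A * card B)"
    by (simp add: power_mult_distrib)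
  also have "card A * card B \<le> (card S)\<^sup>2 div 4"
  proof -
    have "card S = card A + card B"
      using AB fins by (simp add: card_Un_disjoint)
    moreover have "4 * (card A * card B) \<le> (card A + card B)\<^sup>2"
    proof -
      have "0 \<le> (int (card A) - int (card B))\<^sup>2" by simp
      then have "int (4 * (card A * card B)) \<le> int ((card A + card B)\<^sup>2)"
        by (simp add: power2_eq_square algebra_simps)
      then show ?thesis by linarith
    qed
    ultimately show ?thesis by (simp add: less_eq_div_iff_mult_less_eq mult.commute)
  qed
  finally have "2 * (a * b) \<le> sqrt (real ((card S)\<^sup>2 div 4))"
    by (intro real_le_rsqrt) simp
  with l show ?thesis by linarith
qed

section \<open>Deletion of vertices\<close>

text \<open>The deleted vertex is one with the smallest entry; \<open>v\<close> only serves to bound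
  that entry. The restriction of \<open>x\<close> is the test vector for the smaller set.\<close>

lemma perron_value_remove_min:
  assumes fin: "finite S" and P: "perron S l x"
    and v: "v \<in> S" "20 * card (nbrs S v) \<le> 9 * card S" and m: "454 \<le> card S"
  obtains u where "u \<in> S" "\<And>l' x'. perron (S - {u}) l' x' \<Longrightarrow> l - 454 / 1000 \<le> l'"
proof -
  obtain u where u: "u \<in> S" and min: "\<And>i. i \<in> S \<Longrightarrow> x u \<le> x i"
    using fin v(1) by (metis arg_min_if_finite(1) arg_min_least empty_iff)
  define a where "a = (x u)\<^sup>2"
  define m where "m = real (card S)"
  define d where "d = real (card (nbrs S v))"
  have x: "0 \<le> x i" for i using P by (simp add: perron_def)
  have l: "0 \<le> l" using perron_value_nonneg[OF P] .
  have a: "0 \<le> a" by (simp add: a_def)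
  have d: "0 \<le> d" "20 * d \<le> 9 * m" using v(2) by (simp_all add: d_def m_def)
  have m454: "454 \<le> m" using assms by (simp add: m_def)
  have a_le: "a \<le> (x i)\<^sup>2" if "i \<in> S" for i
    using min[OF that] x by (simp add: a_def power_mono)
  have "(\<Sum>i\<in>S. a) \<le> sqnorm S x"
    unfolding sqnorm_def using a_le by (intro sum_mono)
  then have ma: "m * a \<le> 1" using P by (simp add: m_def perron_def)
  \<comment> \<open>Each of the \<open>m - d\<close> entries outside the neighbourhood of
    \<open>v\<close> has square at least \<open>a\<close>, so the neighbourhood carries at most
    \<open>1 - (m - d) * a\<close> of the norm.\<close>
  have key: "l\<^sup>2 * a + d * (m - d) * a \<le> d"
  proof -
    have "l\<^sup>2 * a \<le> (l * x v)\<^sup>2"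
      using a_le[OF v(1)] by (simp add: power_mult_distrib mult_left_mono)
    also have "\<dots> = (\<Sum>j\<in>nbrs S v. x j)\<^sup>2"
      using perron_eigen[OF fin P v(1)] by (simp add: adj_eq_sum_nbrs[OF fin])
    also have "\<dots> \<le> sqnorm (nbrs S v) x * d"
      unfolding sqnorm_def d_def by (rule sum_squared_le_sum_of_squares)
    also have "\<dots> \<le> (1 - (m - d) * a) * d"
    proof (rule mult_right_mono)
      have "sqnorm S x = sqnorm (nbrs S v) x + sqnorm (S - nbrs S v) x"
        unfolding sqnorm_def using sum.subset_diff[OF nbrs_subset fin] by (metis add.commute)
      moreover have "(\<Sum>i\<in>S - nbrs S v. a) \<le> sqnorm (S - nbrs S v) x"
        unfolding sqnorm_def using a_le by (intro sum_mono) auto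
      moreover have "real (card (S - nbrs S v)) = m - d"
        using fin card_mono[OF fin nbrs_subset[of S v]]
        by (simp add: m_def d_def card_Diff_subset nbrs_subset of_nat_diff)
      ultimately show "sqnorm (nbrs S v) x \<le> 1 - (m - d) * a"
        using P by (simp add: perron_def)
    qed (simp add: d_def)
    finally show ?thesis by (simp add: algebra_simps)
  qed
  \<comment> \<open>From \<open>d \<le> 9 / 20 * m\<close> follows
    \<open>d / (m - d) \<le> 9 / 11\<close>, whence
    \<open>(l * a)\<^sup>2 \<le> 9 / 44\<close>.\<close>
  have la: "l * a \<le> 453 / 1000"
  proof (cases "d = 0")
    case True
    then have "l\<^sup>2 * a \<le> 0" using key by simp
    then have "l * a = 0" using a l by (auto simp: mult_le_0_iff)
    then show ?thesis by linarith
  next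
    case False
    \<comment> \<open>AM-GM for the two summands on the left of \<open>key\<close>\<close>
    have "4 * (l\<^sup>2 * a) * (d * (m - d) * a) \<le> (l\<^sup>2 * a + d * (m - d) * a)\<^sup>2"
      using zero_le_power2[of "l\<^sup>2 * a - d * (m - d) * a"] by (simp add: power2_eq_square algebra_simps)
    also have "\<dots> \<le> d\<^sup>2"
      using key a d m454 by (intro power_mono) auto
    finally have "d * (4 * (l * a)\<^sup>2 * (m - d)) \<le> d * d"
      by (simp add: power2_eq_square algebra_simps)
    then have "4 * (l * a)\<^sup>2 * (m - d) \<le> d"
      using False d by simp
    moreover have "4 * (l * a)\<^sup>2 * (11 / 20 * m) \<le> 4 * (l * a)\<^sup>2 * (m - d)"
      by (rule mult_left_mono) (use d in simp_all)
    ultimately have "m * (44 * (l * a)\<^sup>2) \<le> m * 9"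
      using d by (simp add: algebra_simps)
    then have "(l * a)\<^sup>2 \<le> 9 / 44" using m454 by simp
    also have "\<dots> \<le> (453 / 1000)\<^sup>2" by (simp add: power2_eq_square)
    finally show ?thesis by (rule power2_le_imp_le) simp
  qed
  have "l - 454 / 1000 \<le> l'" if P': "perron (S - {u}) l' x'" for l' x'
  proof -
    have "quad (S - {u}) x = l - 2 * (l * a)"
      using quad_remove[OF fin u, of x] perron_eigen[OF fin P u] P
      by (simp add: perron_def a_def power2_eq_square algebra_simps)
    moreover have "sqnorm (S - {u}) x = 1 - a"
      using sqnorm_remove[OF fin u, of x] P by (simp add: perron_def a_def)
    ultimately have ineq: "l - 2 * (l * a) \<le> l' * (1 - a)"
      using P' by (metis perron_def)
    \<comment> \<open>Since \<open>a \<le> 1 / 454\<close>, dividing by \<open>1 - a\<close> raises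
      the loss from 0.453 to at most 0.454.\<close>
    have "454 * a \<le> 1" using ma m454 a mult_right_mono[of 454 m a] by linarith
    then have "453 / 1000 \<le> 454 / 1000 * (1 - a)" and pos: "0 < 1 - a" by auto
    then have "(l - 454 / 1000) * (1 - a) \<le> l' * (1 - a)"
      using ineq la by (simp add: left_diff_distrib right_diff_distrib)
    then show ?thesis using pos by simp
  qed
  with u show thesis using that by blast
qed

text \<open>The bound with \<open>C\<close> survives each deletion, since both of its sides drop in
  step. Together with \<open>l \<le> card S\<close> it keeps the set large, in particular of at
  least 454 vertices, as the deletion lemma requires.\<close>

lemma dense_induced_subgraph:
  assumes "finite S" "perron S l x" "sqrt (real ((card S)\<^sup>2 div 4)) < l"
    "C + 454 / 1000 * card S \<le> l" "454 \<le> C"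
  shows "\<exists>T l x. T \<subseteq> S \<and> perron T l x \<and> sqrt (real ((card T)\<^sup>2 div 4)) < l \<and>
    C + 454 / 1000 * card T \<le> l \<and> (\<forall>v\<in>T. 9 * card T < 20 * card (nbrs T v))"
  using assms
proof (induction "card S" arbitrary: S l x)
  case 0
  then show ?case by (simp add: perron_def sqnorm_def)
next
  case (Suc k)
  note fin = Suc.prems(1) and P = Suc.prems(2)
  show ?case
  proof (cases "\<forall>v\<in>S. 9 * card S < 20 * card (nbrs S v)")
    case True
    then show ?thesis using Suc.prems by blast
  next
    case False
    then obtain v where v: "v \<in> S" "20 * card (nbrs S v) \<le> 9 * card S"
      by (auto simp: not_less)
    have "C + 454 / 1000 * card S \<le> card S"
      using perron_value_le_card[OF fin P] Suc.prems(4) by linarith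
    then have m: "454 \<le> card S"
      using Suc.prems(5) by linarith
    obtain u where u: "u \<in> S" "\<And>l' x'. perron (S - {u}) l' x' \<Longrightarrow> l - 454 / 1000 \<le> l'"
      using perron_value_remove_min[OF fin P v m] by blast
    have card: "card (S - {u}) = k" using Suc.hyps(2) fin u by simp
    then have "0 < card (S - {u})" using m Suc.hyps(2) by linarith
    then have "S - {u} \<noteq> {}" by force
    then obtain l' x' where P': "perron (S - {u}) l' x'"
      using perron_exists fin by blast
    have l': "l - 454 / 1000 \<le> l'" using u(2)[OF P'] .
    \<comment> \<open>The threshold falls by about 1/2 and \<open>l\<close> by at most 0.454; for
      \<open>454 \<le> card S\<close> the gap of 0.046 absorbs the rounding in
      \<open>div 4\<close>.\<close>
    have "real k / 2 + 454 / 1000 < l"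
    proof (rule ccontr)
      define r where "r = real (card S)"
      have r: "real k = r - 1" "454 \<le> r" using Suc.hyps(2) m by (auto simp: r_def)
      assume "\<not> real k / 2 + 454 / 1000 < l"
      then have "l \<le> r / 2 - 46 / 1000" using r(1) by linarith
      then have "sqrt (real ((card S)\<^sup>2 div 4)) \<le> r / 2 - 46 / 1000"
        using Suc.prems(3) by linarith
      then have "real ((card S)\<^sup>2 div 4) \<le> (r / 2 - 46 / 1000)\<^sup>2"
        by (rule sqrt_le_D)
      moreover have "r\<^sup>2 \<le> 4 * real ((card S)\<^sup>2 div 4) + 3"
        using real_div_4_bounds(2)[of "(card S)\<^sup>2"] by (simp add: r_def)
      moreover have "(r / 2 - 46 / 1000)\<^sup>2 = r\<^sup>2 / 4 - 46 / 1000 * r + (46 / 1000)\<^sup>2"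
        by (simp add: power2_eq_square algebra_simps)
      moreover have "(46 / 1000 :: real)\<^sup>2 \<le> 1" by (simp add: power2_eq_square)
      ultimately show False
        using r(2) by linarith
    qed
    then have "real k / 2 < l'" using l' by linarith
    moreover have "sqrt (real (k\<^sup>2 div 4)) \<le> real k / 2"
      using real_div_4_bounds(1)[of "k\<^sup>2"] by (intro real_le_lsqrt) (simp_all add: power_divide)
    ultimately have big: "sqrt (real ((card (S - {u}))\<^sup>2 div 4)) < l'" using card by simp
    have "C + 454 / 1000 * card (S - {u}) \<le> l'"
      using Suc.prems(4) l' unfolding card Suc.hyps(2)[symmetric] of_nat_Suc by argo
    then obtain T l x where "T \<subseteq> S - {u}" "perron T l x" "sqrt (real ((card T)\<^sup>2 div 4)) < l"
      "C + 454 / 1000 * card T \<le> l" "\<forall>v\<in>T. 9 * card T < 20 * card (nbrs T v)"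
      using Suc.hyps(1)[OF card[symmetric] _ P' big _ Suc.prems(5)] fin by blast
    then show ?thesis by blast
  qed
qed

end

subsection \<open>The theorem\<close>

text \<open>The Perron vector makes the finite set of eigenvalues nonempty, so its
  \<open>Max\<close> is an eigenvalue; an eigenvector for it is then tested in the quadratic
  form.\<close>

lemma spectral_radius_le_perron_value:
  fixes E :: "nat \<Rightarrow> nat \<Rightarrow> bool"
  assumes "loopless_graph E" and P: "loopless_graph.perron E {0..<n} l x"
  shows "spectral_radius_graph n E \<le> l"
proof -
  interpret loopless_graph E by fact
  let ?V = "{0..<n}" and ?A = "adj_matrix n E"
  have carrier: "?A \<in> carrier_mat n n" by (simp add: adj_matrix_def)
  have mult: "?A *\<^sub>v v = vec n (adj ?V (\<lambda>i. v $ i))" if "v \<in> carrier_vec n" for v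
    using that
    by (intro eq_vecI) (auto simp: adj_matrix_def adj_def scalar_prod_def intro!: sum.cong)
  have norm: "sqnorm ?V x = 1" using P by (simp add: perron_def)
  have "eigenvector ?A (vec n x) l"
  proof -
    have "vec n x \<noteq> 0\<^sub>v n"
    proof
      assume "vec n x = 0\<^sub>v n"
      then have "x i = 0" if "i < n" for i using that by (metis index_vec index_zero_vec(1))
      then show False using norm by (simp add: sqnorm_def)
    qed
    moreover have "?A *\<^sub>v vec n x = l \<cdot>\<^sub>v vec n x"
    proof -
      have "adj ?V (\<lambda>i. vec n x $ i) j = l * x j" if "j < n" for j
        using perron_eigen[OF _ P, of j] that adj_cong[of ?V "\<lambda>i. vec n x $ i" x j] by simp
      then show ?thesis by (subst mult) (auto intro!: eq_vecI)
    qed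
    ultimately show ?thesis using carrier by (simp add: eigenvector_def)
  qed
  then have "{k. eigenvalue ?A k} \<noteq> {}" by (auto simp: eigenvalue_def)
  moreover have "finite {k. eigenvalue ?A k}"
    using card_finite_spectrum(1)[OF carrier] by (simp add: spectrum_def)
  ultimately have "eigenvalue ?A (spectral_radius_graph n E)"
    unfolding spectral_radius_graph_def using Max_in by blast
  then obtain v where v: "v \<in> carrier_vec n" "v \<noteq> 0\<^sub>v n"
    "?A *\<^sub>v v = spectral_radius_graph n E \<cdot>\<^sub>v v"
    using carrier by (auto simp: eigenvalue_def eigenvector_def)
  define y where "y i = v $ i" for i
  have "adj ?V y i = spectral_radius_graph n E * y i" if "i < n" for i
    using arg_cong[OF v(3), of "\<lambda>w. w $ i"] that v(1) by (simp add: mult y_def[abs_def])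
  then have "quad ?V y = spectral_radius_graph n E * sqnorm ?V y"
    by (simp add: quad_def sqnorm_def sum_distrib_left power2_eq_square mult_ac)
  then have "spectral_radius_graph n E * sqnorm ?V y \<le> l * sqnorm ?V y"
    using P by (metis perron_def)
  moreover have "0 < sqnorm ?V y"
  proof -
    obtain i where "i < n" "v $ i \<noteq> 0"
      using v by (metis carrier_vecD eq_vecI index_zero_vec)
    then have "0 < (y i)\<^sup>2" "(y i)\<^sup>2 \<le> sqnorm ?V y"
      unfolding sqnorm_def by (auto simp: y_def intro!: member_le_sum)
    then show ?thesis by linarith
  qed
  ultimately show ?thesis by simp
qed

lemma has_cycle_if_cycle_within:
  assumes "loopless_graph E" and "loopless_graph.cycle_within E S t" and "S \<subseteq> {0..<n}" and "0 < t"
  shows "has_cycle n E t"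
proof -
  interpret loopless_graph E by fact
  obtain vs where vs: "length vs = t" "distinct vs" "set vs \<subseteq> S" "successively E vs"
    "E (last vs) (hd vs)"
    using assms(2) by (auto simp: cycle_within_def)
  have ne: "vs \<noteq> []" using vs(1) assms(4) by auto
  have "E (vs ! i) (vs ! ((i + 1) mod t))" if "i < t" for i
  proof (cases "i + 1 < t")
    case True
    then show ?thesis using vs by (simp add: successively_conv_nth)
  next
    case False
    then have "i + 1 = t" using that by simp
    then show ?thesis
      using vs ne by (auto simp: last_conv_nth hd_conv_nth)
  qed
  then show ?thesis
    unfolding has_cycle_def using vs assms(3) by blast
qed

theorem theorem1:
  shows "\<exists>n0::nat. \<forall>n\<ge>n0. \<forall>E. simple_graph n E \<longrightarrow>
           spectral_radius_graph n E > sqrt (real (n^2 div 4)) \<longrightarrow>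
           (\<forall>t::nat. 3 \<le> t \<and> real t \<le> real n / 320 \<longrightarrow> has_cycle n E t)"
proof (intro exI allI impI)
  fix n :: nat and E and t :: nat
  \<comment> \<open>This fixes \<open>n0\<close> as 10000, so that \<open>46 / 1000 * n - 1\<close>
    is at least 454.\<close>
  assume n: "10000 \<le> n" and G: "simple_graph n E"
    and mu: "sqrt (real (n^2 div 4)) < spectral_radius_graph n E"
    and t: "3 \<le> t \<and> real t \<le> real n / 320"
  have graph: "loopless_graph E"
    using G by unfold_locales (auto simp: simple_graph_def)
  interpret loopless_graph E by (rule graph)
  obtain l x where P: "perron {0..<n} l x"
    using perron_exists[of "{0..<n}"] n by auto
  have l: "sqrt (real (n^2 div 4)) < l"
    using mu spectral_radius_le_perron_value[OF graph P] by linarith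
  \<comment> \<open>The \<open>- 1\<close> absorbs the rounding; subtracting
    \<open>454 / 1000 * n\<close> leaves the value used for \<open>C\<close>.\<close>
  have "real n / 2 - 1 \<le> sqrt (real (n^2 div 4))"
  proof (rule real_le_rsqrt)
    have "(real n / 2 - 1)\<^sup>2 = (real n)\<^sup>2 / 4 - real n + 1"
      by (simp add: power2_eq_square algebra_simps)
    then show "(real n / 2 - 1)\<^sup>2 \<le> real (n^2 div 4)"
      using real_div_4_bounds(2)[of "n\<^sup>2"] n by simp
  qed
  then have "(46 / 1000 * real n - 1) + 454 / 1000 * card {0..<n} \<le> l"
    using l by simp
  then obtain T l' x' where T: "T \<subseteq> {0..<n}" "perron T l' x'"
    "sqrt (real ((card T)\<^sup>2 div 4)) < l'" "46 / 1000 * real n - 1 + 454 / 1000 * card T \<le> l'"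
    "\<forall>v\<in>T. 9 * card T < 20 * card (nbrs T v)"
    using dense_induced_subgraph[OF _ P, of "46 / 1000 * real n - 1"] l n by auto
  have fin: "finite T" using T(1) finite_subset by blast
  have nb: "\<not> bipartite T"
    using perron_value_le_if_bipartite[OF fin T(2)] T(3) by auto
  have m: "46 / 1000 * real n - 1 \<le> 546 / 1000 * real (card T)"
    using perron_value_le_card[OF fin T(2)] T(4) by linarith
  \<comment> \<open>The least integer above \<open>9 / 20 * card T\<close>, as the degree bound is
    strict.\<close>
  define \<delta> where "\<delta> = 9 * card T div 20 + 1"
  have \<delta>: "9 * card T \<le> 20 * \<delta>" unfolding \<delta>_def by presburger
  then have \<delta>': "9 * real (card T) \<le> 20 * real \<delta>" by linarith
  have "cycle_within T t"
  proof (rule cycle_if_not_bipartite[OF fin _ _ _ nb])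
    show "\<delta> \<le> card (nbrs T v)" if "v \<in> T" for v
      using T(5) that by (force simp: \<delta>_def)
    \<comment> \<open>As \<open>5 * \<delta>\<close> is at least \<open>9 / 4 * card T\<close>, it
      suffices that \<open>5 * t + 6 \<le> card T / 4\<close>. By \<open>m\<close> the right side is
      about \<open>0.021 * n\<close> or more, while \<open>5 * t \<le> n / 64\<close>.\<close>
    have "real (2 * card T + 5 * t + 6) \<le> real (5 * \<delta>)"
      using m \<delta>' t n by simp
    then show "2 * card T + 5 * t + 6 \<le> 5 * \<delta>" by linarith
    have "real (3 * t + 6) \<le> real \<delta>"
      using m \<delta>' t n by simp
    then show "3 * t + 6 \<le> \<delta>" by linarith
    show "3 \<le> t" using t by simp
  qed
  then show "has_cycle n E t"
    using has_cycle_if_cycle_within[OF graph _ T(1)] t by simp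
qed

end
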